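(* (Validity of quantum teleportation.) Let $\mathcal{C}$ be a dagger compact closed category with dagger biproducts, let $Q$ be an object of $\mathcal{C}$ and let $\beta_1,\beta_2,\beta_3,\beta_4\colon Q\to Q$ be unitary arrows. Then the composite $$Q\xrightarrow{\ \sigma_{I,Q}\circ\lambda_Q^{-1}\ }Q\otimes I\xrightarrow{\ \mathbf{1}_Q\otimes\ulcorner\mathbf{1}_Q\urcorner\ }Q\otimes(Q^\ast\otimes Q)\xrightarrow{\ \alpha_{Q,Q^\ast,Q}\ }(Q\otimes Q^\ast)\otimes Q\xrightarrow{\ \langle\llcorner\beta_i\lrcorner\rangle_{i=1}^{4}\otimes\mathbf{1}_Q\ }(4\cdot I)\otimes Q\xrightarrow{\ (4\cdot\lambda_Q)\circ\upsilon\ }4\cdot Q\xrightarrow{\ \bigoplus_{i=1}^{4}\beta_i^{-1}\ }4\cdot Q$$ is equal to the diagonal $\langle\mathbf{1}_Q,\mathbf{1}_Q,\mathbf{1}_Q,\mathbf{1}_Q\rangle\colon Q\to4\cdot Q$.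
   Context: A compact closed category is a symmetric monoidal category with natural isomorphisms $\alpha_{a,b,c}\colon a\otimes(b\otimes c)\to(a\otimes b)\otimes c$, $\lambda_a\colon I\otimes a\to a$, $\sigma_{a,b}\colon a\otimes b\to b\otimes a$, in which every object $a$ has a dual $a^\ast$ with $\eta_a\colon I\to a^\ast\otimes a$ and $\varepsilon_a\colon a\otimes a^\ast\to I$ satisfying $(a^\ast\otimes\varepsilon_a)\circ\alpha^{-1}_{a^\ast,a,a^\ast}\circ(\eta_a\otimes a^\ast)=\sigma_{I,a^\ast}$ and $(\varepsilon_a\otimes a)\circ\alpha_{a,a^\ast,a}\circ(a\otimes\eta_a)=\sigma_{a,I}$. It is dagger compact closed if it has an identity-on-objects involutive functor $\dagger\colon\mathcal{C}\to\mathcal{C}^{\mathrm{op}}$ with $(f\otimes g)^\dagger=f^\dagger\otimes g^\dagger$, $\alpha^\dagger=\alpha^{-1}$, $\lambda^\dagger=\lambda^{-1}$, $\sigma_{a,b}^\dagger=\sigma_{b,a}$, $\varepsilon_a^\dagger=\sigma_{a^\ast,a}\circ\eta_a$. Biproducts are dagger biproducts if $(\pi^i)^\dagger=\iota^i$. An arrow $f$ is unitary if $f^\dagger$ is its two-sided inverse. For $f\colon a\to b$, the name is $\ulcorner f\urcorner=(a^\ast\otimes f)\circ\eta_a\colon I\to a^\ast\otimes b$ and the coname is $\llcorner f\lrcorner=\varepsilon_b\circ(f\otimes b^\ast)\colon a\otimes b^\ast\to I$. $4\cdot a$ and $4\cdot f$ denote the fourfold biproducts, associated to the left, of an object $a$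 and an arrow $f$; $\langle f_1,\dots,f_4\rangle$ is the arrow into the biproduct with components $f_1,\dots,f_4$. $\upsilon\colon(4\cdot I)\otimes Q\to4\cdot(I\otimes Q)$ is the distributivity isomorphism, whose $i$-th component is $\pi^i\otimes\mathbf{1}_Q$ with $\pi^i\colon4\cdot I\to I$ the $i$-th projection. *)

theory Defs
  imports Main
begin

section \<open>Categories\<close>

record ('o, 'a) cat =
  Obj :: "'o set"
  Arr :: "'a set"
  source :: "'a \<Rightarrow> 'o"
  target :: "'a \<Rightarrow> 'o"
  ident :: "'o \<Rightarrow> 'a"  ("\<one>\<index>")
  compose :: "'a \<Rightarrow> 'a \<Rightarrow> 'a"  (infixr "\<cdot>\<index>" 60)

definition hom :: "('o, 'a, 'm) cat_scheme \<Rightarrow> 'o \<Rightarrow> 'o \<Rightarrow> 'a set" where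
  "hom C a b = {f \<in> Arr C. source C f = a \<and> target C f = b}"

definition inverse_arrows :: "('o, 'a, 'm) cat_scheme \<Rightarrow> 'a \<Rightarrow> 'a \<Rightarrow> bool" where
  "inverse_arrows C f g \<longleftrightarrow>
     f \<in> Arr C \<and> g \<in> hom C (target C f) (source C f) \<and>
     g \<cdot>\<^bsub>C\<^esub> f = \<one>\<^bsub>C\<^esub> (source C f) \<and> f \<cdot>\<^bsub>C\<^esub> g = \<one>\<^bsub>C\<^esub> (target C f)"

definition iso_arrow :: "('o, 'a, 'm) cat_scheme \<Rightarrow> 'a \<Rightarrow> bool" where
  "iso_arrow C f \<longleftrightarrow> (\<exists>g. inverse_arrows C f g)"

definition inverse_arrow :: "('o, 'a, 'm) cat_scheme \<Rightarrow> 'a \<Rightarrow> 'a"  ("_\<^sup>-\<^sup>1\<index>" [1000] 999) where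
  "f\<^sup>-\<^sup>1\<^bsub>C\<^esub> = (THE g. inverse_arrows C f g)"

locale category =
  fixes C :: "('o, 'a, 'm) cat_scheme" (structure)
  assumes source_closed: "f \<in> Arr C \<Longrightarrow> source C f \<in> Obj C"
    and target_closed: "f \<in> Arr C \<Longrightarrow> target C f \<in> Obj C"
    and ident_closed: "a \<in> Obj C \<Longrightarrow> \<one> a \<in> hom C a a"
    and compose_closed: "\<lbrakk>f \<in> hom C a b; g \<in> hom C b c\<rbrakk> \<Longrightarrow> g \<cdot> f \<in> hom C a c"
    and ident_left: "f \<in> hom C a b \<Longrightarrow> \<one> b \<cdot> f = f"
    and ident_right: "f \<in> hom C a b \<Longrightarrow> f \<cdot> \<one> a = f"
    and compose_assoc: "\<lbrakk>f \<in> hom C a b; g \<in> hom C b c; h \<in> hom C c d\<rbrakk>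
      \<Longrightarrow> (h \<cdot> g) \<cdot> f = h \<cdot> (g \<cdot> f)"

section \<open>Symmetric monoidal categories\<close>

text \<open>The tensor product is written \<open>\<otimes>\<close> on objects and \<open>\<boxtimes>\<close> on arrows.\<close>

record ('o, 'a) sym_monoidal_cat = "('o, 'a) cat" +
  unit_obj :: 'o  ("\<I>\<index>")
  tensor_obj :: "'o \<Rightarrow> 'o \<Rightarrow> 'o"  (infixr "\<otimes>\<index>" 75)
  tensor_arr :: "'a \<Rightarrow> 'a \<Rightarrow> 'a"  (infixr "\<boxtimes>\<index>" 75)
  assoc :: "'o \<Rightarrow> 'o \<Rightarrow> 'o \<Rightarrow> 'a"  ("\<alpha>\<index>")
  lunit :: "'o \<Rightarrow> 'a"  ("\<lambda>\<index>")
  sym_arr :: "'o \<Rightarrow> 'o \<Rightarrow> 'a"  ("\<sigma>\<index>")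

text \<open>The right unitor is not primitive: it is \<open>\<lambda>\<^sub>a \<circ> \<sigma>\<^sub>a\<^sub>,\<^sub>I\<close>, and the triangle axiom is stated with it.\<close>

locale symmetric_monoidal_category = category C
  for C :: "('o, 'a, 'm) sym_monoidal_cat_scheme" (structure) +
  assumes unit_obj_closed: "\<I> \<in> Obj C"
    and tensor_obj_closed: "\<lbrakk>a \<in> Obj C; b \<in> Obj C\<rbrakk> \<Longrightarrow> a \<otimes> b \<in> Obj C"
    and tensor_arr_closed: "\<lbrakk>f \<in> hom C a b; g \<in> hom C c d\<rbrakk> \<Longrightarrow> f \<boxtimes> g \<in> hom C (a \<otimes> c) (b \<otimes> d)"
    and tensor_ident: "\<lbrakk>a \<in> Obj C; b \<in> Obj C\<rbrakk> \<Longrightarrow> \<one> a \<boxtimes> \<one> b = \<one> (a \<otimes> b)"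
    and tensor_compose:
      "\<lbrakk>f \<in> hom C a b; g \<in> hom C b c; f' \<in> hom C a' b'; g' \<in> hom C b' c'\<rbrakk>
       \<Longrightarrow> (g \<cdot> f) \<boxtimes> (g' \<cdot> f') = (g \<boxtimes> g') \<cdot> (f \<boxtimes> f')"
    and assoc_closed: "\<lbrakk>a \<in> Obj C; b \<in> Obj C; c \<in> Obj C\<rbrakk>
      \<Longrightarrow> \<alpha> a b c \<in> hom C (a \<otimes> (b \<otimes> c)) ((a \<otimes> b) \<otimes> c)"
    and assoc_iso: "\<lbrakk>a \<in> Obj C; b \<in> Obj C; c \<in> Obj C\<rbrakk> \<Longrightarrow> iso_arrow C (\<alpha> a b c)"
    and assoc_natural: "\<lbrakk>f \<in> hom C a a'; g \<in> hom C b b'; h \<in> hom C c c'\<rbrakk>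
      \<Longrightarrow> \<alpha> a' b' c' \<cdot> (f \<boxtimes> (g \<boxtimes> h)) = ((f \<boxtimes> g) \<boxtimes> h) \<cdot> \<alpha> a b c"
    and lunit_closed: "a \<in> Obj C \<Longrightarrow> \<lambda> a \<in> hom C (\<I> \<otimes> a) a"
    and lunit_iso: "a \<in> Obj C \<Longrightarrow> iso_arrow C (\<lambda> a)"
    and lunit_natural: "f \<in> hom C a b \<Longrightarrow> \<lambda> b \<cdot> (\<one> \<I> \<boxtimes> f) = f \<cdot> \<lambda> a"
    and sym_closed: "\<lbrakk>a \<in> Obj C; b \<in> Obj C\<rbrakk> \<Longrightarrow> \<sigma> a b \<in> hom C (a \<otimes> b) (b \<otimes> a)"
    and sym_natural: "\<lbrakk>f \<in> hom C a a'; g \<in> hom C b b'\<rbrakk>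
      \<Longrightarrow> \<sigma> a' b' \<cdot> (f \<boxtimes> g) = (g \<boxtimes> f) \<cdot> \<sigma> a b"
    and sym_sym: "\<lbrakk>a \<in> Obj C; b \<in> Obj C\<rbrakk> \<Longrightarrow> \<sigma> b a \<cdot> \<sigma> a b = \<one> (a \<otimes> b)"
    and pentagon: "\<lbrakk>a \<in> Obj C; b \<in> Obj C; c \<in> Obj C; d \<in> Obj C\<rbrakk>
      \<Longrightarrow> \<alpha> (a \<otimes> b) c d \<cdot> \<alpha> a b (c \<otimes> d)
        = (\<alpha> a b c \<boxtimes> \<one> d) \<cdot> \<alpha> a (b \<otimes> c) d \<cdot> (\<one> a \<boxtimes> \<alpha> b c d)"
    and triangle: "\<lbrakk>a \<in> Obj C; b \<in> Obj C\<rbrakk>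
      \<Longrightarrow> ((\<lambda> a \<cdot> \<sigma> a \<I>) \<boxtimes> \<one> b) \<cdot> \<alpha> a \<I> b = \<one> a \<boxtimes> \<lambda> b"
    and hexagon: "\<lbrakk>a \<in> Obj C; b \<in> Obj C; c \<in> Obj C\<rbrakk>
      \<Longrightarrow> \<alpha> c a b \<cdot> \<sigma> (a \<otimes> b) c \<cdot> \<alpha> a b c
        = (\<sigma> a c \<boxtimes> \<one> b) \<cdot> \<alpha> a c b \<cdot> (\<one> a \<boxtimes> \<sigma> b c)"

section \<open>Compact closed categories\<close>

record ('o, 'a) compact_cat = "('o, 'a) sym_monoidal_cat" +
  dual :: "'o \<Rightarrow> 'o"  ("_\<^sup>\<star>\<index>" [1000] 999)
  dual_unit :: "'o \<Rightarrow> 'a"  ("\<eta>\<index>")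
  dual_counit :: "'o \<Rightarrow> 'a"  ("\<epsilon>\<index>")

locale compact_closed_category = symmetric_monoidal_category C
  for C :: "('o, 'a, 'm) compact_cat_scheme" (structure) +
  assumes dual_closed: "a \<in> Obj C \<Longrightarrow> a\<^sup>\<star> \<in> Obj C"
    and dual_unit_closed: "a \<in> Obj C \<Longrightarrow> \<eta> a \<in> hom C \<I> (a\<^sup>\<star> \<otimes> a)"
    and dual_counit_closed: "a \<in> Obj C \<Longrightarrow> \<epsilon> a \<in> hom C (a \<otimes> a\<^sup>\<star>) \<I>"
    and snake_dual: "a \<in> Obj C
      \<Longrightarrow> (\<one> (a\<^sup>\<star>) \<boxtimes> \<epsilon> a) \<cdot> (\<alpha> (a\<^sup>\<star>) a (a\<^sup>\<star>))\<^sup>-\<^sup>1 \<cdot> (\<eta> a \<boxtimes> \<one> (a\<^sup>\<star>)) = \<sigma> \<I> (a\<^sup>\<star>)"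
    and snake: "a \<in> Obj C
      \<Longrightarrow> (\<epsilon> a \<boxtimes> \<one> a) \<cdot> \<alpha> a (a\<^sup>\<star>) a \<cdot> (\<one> a \<boxtimes> \<eta> a) = \<sigma> a \<I>"

definition name :: "('o, 'a, 'm) compact_cat_scheme \<Rightarrow> 'a \<Rightarrow> 'a"  ("\<ulcorner>_\<urcorner>\<index>") where
  "\<ulcorner>f\<urcorner>\<^bsub>C\<^esub> = (\<one>\<^bsub>C\<^esub> ((source C f)\<^sup>\<star>\<^bsub>C\<^esub>) \<boxtimes>\<^bsub>C\<^esub> f) \<cdot>\<^bsub>C\<^esub> \<eta>\<^bsub>C\<^esub> (source C f)"

definition coname :: "('o, 'a, 'm) compact_cat_scheme \<Rightarrow> 'a \<Rightarrow> 'a"  ("\<llcorner>_\<lrcorner>\<index>") where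
  "\<llcorner>f\<lrcorner>\<^bsub>C\<^esub> = \<epsilon>\<^bsub>C\<^esub> (target C f) \<cdot>\<^bsub>C\<^esub> (f \<boxtimes>\<^bsub>C\<^esub> \<one>\<^bsub>C\<^esub> ((target C f)\<^sup>\<star>\<^bsub>C\<^esub>))"

section \<open>Dagger compact closed categories\<close>

record ('o, 'a) dagger_compact_cat = "('o, 'a) compact_cat" +
  dagger :: "'a \<Rightarrow> 'a"  ("_\<^sup>\<dagger>\<index>" [1000] 999)

locale dagger_compact_closed_category = compact_closed_category C
  for C :: "('o, 'a, 'm) dagger_compact_cat_scheme" (structure) +
  assumes dagger_closed: "f \<in> hom C a b \<Longrightarrow> f\<^sup>\<dagger> \<in> hom C b a"
    and dagger_ident: "a \<in> Obj C \<Longrightarrow> (\<one> a)\<^sup>\<dagger> = \<one> a"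
    and dagger_compose: "\<lbrakk>f \<in> hom C a b; g \<in> hom C b c\<rbrakk> \<Longrightarrow> (g \<cdot> f)\<^sup>\<dagger> = f\<^sup>\<dagger> \<cdot> g\<^sup>\<dagger>"
    and dagger_dagger: "f \<in> Arr C \<Longrightarrow> (f\<^sup>\<dagger>)\<^sup>\<dagger> = f"
    and dagger_tensor: "\<lbrakk>f \<in> Arr C; g \<in> Arr C\<rbrakk> \<Longrightarrow> (f \<boxtimes> g)\<^sup>\<dagger> = f\<^sup>\<dagger> \<boxtimes> g\<^sup>\<dagger>"
    and dagger_assoc: "\<lbrakk>a \<in> Obj C; b \<in> Obj C; c \<in> Obj C\<rbrakk> \<Longrightarrow> (\<alpha> a b c)\<^sup>\<dagger> = (\<alpha> a b c)\<^sup>-\<^sup>1"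
    and dagger_lunit: "a \<in> Obj C \<Longrightarrow> (\<lambda> a)\<^sup>\<dagger> = (\<lambda> a)\<^sup>-\<^sup>1"
    and dagger_sym: "\<lbrakk>a \<in> Obj C; b \<in> Obj C\<rbrakk> \<Longrightarrow> (\<sigma> a b)\<^sup>\<dagger> = \<sigma> b a"
    and dagger_counit: "a \<in> Obj C \<Longrightarrow> (\<epsilon> a)\<^sup>\<dagger> = \<sigma> (a\<^sup>\<star>) a \<cdot> \<eta> a"

definition unitary :: "('o, 'a, 'm) dagger_compact_cat_scheme \<Rightarrow> 'a \<Rightarrow> bool" where
  "unitary C f \<longleftrightarrow> inverse_arrows C f (f\<^sup>\<dagger>\<^bsub>C\<^esub>)"

section \<open>Dagger biproducts\<close>

text \<open>The biproduct is written \<open>\<oplus>\<close> on objects and \<open>\<boxplus>\<close> on arrows.\<close>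

record ('o, 'a) dagger_compact_biprod_cat = "('o, 'a) dagger_compact_cat" +
  zero_obj :: 'o  ("\<zero>\<index>")
  biprod_obj :: "'o \<Rightarrow> 'o \<Rightarrow> 'o"  (infixl "\<oplus>\<index>" 70)
  proj1 :: "'o \<Rightarrow> 'o \<Rightarrow> 'a"  ("\<pi>\<^sub>1\<index>")
  proj2 :: "'o \<Rightarrow> 'o \<Rightarrow> 'a"  ("\<pi>\<^sub>2\<index>")
  inj1 :: "'o \<Rightarrow> 'o \<Rightarrow> 'a"  ("\<iota>\<^sub>1\<index>")
  inj2 :: "'o \<Rightarrow> 'o \<Rightarrow> 'a"  ("\<iota>\<^sub>2\<index>")

definition zero_arrow :: "('o, 'a, 'm) dagger_compact_biprod_cat_scheme \<Rightarrow> 'o \<Rightarrow> 'o \<Rightarrow> 'a" where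
  "zero_arrow C a b = (THE g. g \<in> hom C \<zero>\<^bsub>C\<^esub> b) \<cdot>\<^bsub>C\<^esub> (THE f. f \<in> hom C a \<zero>\<^bsub>C\<^esub>)"

locale dagger_compact_closed_biproduct_category = dagger_compact_closed_category C
  for C :: "('o, 'a, 'm) dagger_compact_biprod_cat_scheme" (structure) +
  assumes zero_obj_closed: "\<zero> \<in> Obj C"
    and zero_initial: "a \<in> Obj C \<Longrightarrow> \<exists>!f. f \<in> hom C \<zero> a"
    and zero_terminal: "a \<in> Obj C \<Longrightarrow> \<exists>!f. f \<in> hom C a \<zero>"
    and biprod_obj_closed: "\<lbrakk>a \<in> Obj C; b \<in> Obj C\<rbrakk> \<Longrightarrow> a \<oplus> b \<in> Obj C"
    and proj1_closed: "\<lbrakk>a \<in> Obj C; b \<in> Obj C\<rbrakk> \<Longrightarrow> \<pi>\<^sub>1 a b \<in> hom C (a \<oplus> b) a"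
    and proj2_closed: "\<lbrakk>a \<in> Obj C; b \<in> Obj C\<rbrakk> \<Longrightarrow> \<pi>\<^sub>2 a b \<in> hom C (a \<oplus> b) b"
    and inj1_closed: "\<lbrakk>a \<in> Obj C; b \<in> Obj C\<rbrakk> \<Longrightarrow> \<iota>\<^sub>1 a b \<in> hom C a (a \<oplus> b)"
    and inj2_closed: "\<lbrakk>a \<in> Obj C; b \<in> Obj C\<rbrakk> \<Longrightarrow> \<iota>\<^sub>2 a b \<in> hom C b (a \<oplus> b)"
    and product: "\<lbrakk>a \<in> Obj C; b \<in> Obj C; f \<in> hom C c a; g \<in> hom C c b\<rbrakk>
      \<Longrightarrow> \<exists>!h. h \<in> hom C c (a \<oplus> b) \<and> \<pi>\<^sub>1 a b \<cdot> h = f \<and> \<pi>\<^sub>2 a b \<cdot> h = g"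
    and coproduct: "\<lbrakk>a \<in> Obj C; b \<in> Obj C; f \<in> hom C a c; g \<in> hom C b c\<rbrakk>
      \<Longrightarrow> \<exists>!h. h \<in> hom C (a \<oplus> b) c \<and> h \<cdot> \<iota>\<^sub>1 a b = f \<and> h \<cdot> \<iota>\<^sub>2 a b = g"
    and proj1_inj1: "\<lbrakk>a \<in> Obj C; b \<in> Obj C\<rbrakk> \<Longrightarrow> \<pi>\<^sub>1 a b \<cdot> \<iota>\<^sub>1 a b = \<one> a"
    and proj2_inj2: "\<lbrakk>a \<in> Obj C; b \<in> Obj C\<rbrakk> \<Longrightarrow> \<pi>\<^sub>2 a b \<cdot> \<iota>\<^sub>2 a b = \<one> b"
    and proj1_inj2: "\<lbrakk>a \<in> Obj C; b \<in> Obj C\<rbrakk> \<Longrightarrow> \<pi>\<^sub>1 a b \<cdot> \<iota>\<^sub>2 a b = zero_arrow C b a"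
    and proj2_inj1: "\<lbrakk>a \<in> Obj C; b \<in> Obj C\<rbrakk> \<Longrightarrow> \<pi>\<^sub>2 a b \<cdot> \<iota>\<^sub>1 a b = zero_arrow C a b"
    and dagger_proj1: "\<lbrakk>a \<in> Obj C; b \<in> Obj C\<rbrakk> \<Longrightarrow> (\<pi>\<^sub>1 a b)\<^sup>\<dagger> = \<iota>\<^sub>1 a b"
    and dagger_proj2: "\<lbrakk>a \<in> Obj C; b \<in> Obj C\<rbrakk> \<Longrightarrow> (\<pi>\<^sub>2 a b)\<^sup>\<dagger> = \<iota>\<^sub>2 a b"

definition biprod_arr ::
    "('o, 'a, 'm) dagger_compact_biprod_cat_scheme \<Rightarrow> 'a \<Rightarrow> 'a \<Rightarrow> 'a"  (infixl "\<boxplus>\<index>" 70) where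
  "f \<boxplus>\<^bsub>C\<^esub> g = (THE h. h \<in> hom C (source C f \<oplus>\<^bsub>C\<^esub> source C g) (target C f \<oplus>\<^bsub>C\<^esub> target C g) \<and>
     \<pi>\<^sub>1\<^bsub>C\<^esub> (target C f) (target C g) \<cdot>\<^bsub>C\<^esub> h = f \<cdot>\<^bsub>C\<^esub> \<pi>\<^sub>1\<^bsub>C\<^esub> (source C f) (source C g) \<and>
     \<pi>\<^sub>2\<^bsub>C\<^esub> (target C f) (target C g) \<cdot>\<^bsub>C\<^esub> h = g \<cdot>\<^bsub>C\<^esub> \<pi>\<^sub>2\<^bsub>C\<^esub> (source C f) (source C g))"

section \<open>Fourfold biproducts\<close>

definition four_obj ::
    "('o, 'a, 'm) dagger_compact_biprod_cat_scheme \<Rightarrow> 'o \<Rightarrow> 'o"  ("four\<index> _" [81] 80) where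
  "four\<^bsub>C\<^esub> a = ((a \<oplus>\<^bsub>C\<^esub> a) \<oplus>\<^bsub>C\<^esub> a) \<oplus>\<^bsub>C\<^esub> a"

definition four_arr ::
    "('o, 'a, 'm) dagger_compact_biprod_cat_scheme \<Rightarrow> 'a \<Rightarrow> 'a"  ("fourarr\<index> _" [81] 80) where
  "fourarr\<^bsub>C\<^esub> f = ((f \<boxplus>\<^bsub>C\<^esub> f) \<boxplus>\<^bsub>C\<^esub> f) \<boxplus>\<^bsub>C\<^esub> f"

text \<open>\<open>four_proj C a i\<close> is the \<open>i\<close>-th projection of the fourfold biproduct of \<open>a\<close>, for \<open>i\<close> in \<open>{1..4}\<close>;
  other indices are not used.\<close>

definition four_proj ::
    "('o, 'a, 'm) dagger_compact_biprod_cat_scheme \<Rightarrow> 'o \<Rightarrow> nat \<Rightarrow> 'a" where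
  "four_proj C a i =
    (if i = 1 then \<pi>\<^sub>1\<^bsub>C\<^esub> a a \<cdot>\<^bsub>C\<^esub> \<pi>\<^sub>1\<^bsub>C\<^esub> (a \<oplus>\<^bsub>C\<^esub> a) a \<cdot>\<^bsub>C\<^esub> \<pi>\<^sub>1\<^bsub>C\<^esub> (a \<oplus>\<^bsub>C\<^esub> a \<oplus>\<^bsub>C\<^esub> a) a
     else if i = 2 then \<pi>\<^sub>2\<^bsub>C\<^esub> a a \<cdot>\<^bsub>C\<^esub> \<pi>\<^sub>1\<^bsub>C\<^esub> (a \<oplus>\<^bsub>C\<^esub> a) a \<cdot>\<^bsub>C\<^esub> \<pi>\<^sub>1\<^bsub>C\<^esub> (a \<oplus>\<^bsub>C\<^esub> a \<oplus>\<^bsub>C\<^esub> a) a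
     else if i = 3 then \<pi>\<^sub>2\<^bsub>C\<^esub> (a \<oplus>\<^bsub>C\<^esub> a) a \<cdot>\<^bsub>C\<^esub> \<pi>\<^sub>1\<^bsub>C\<^esub> (a \<oplus>\<^bsub>C\<^esub> a \<oplus>\<^bsub>C\<^esub> a) a
     else \<pi>\<^sub>2\<^bsub>C\<^esub> (a \<oplus>\<^bsub>C\<^esub> a \<oplus>\<^bsub>C\<^esub> a) a)"

definition four_tuple ::
    "('o, 'a, 'm) dagger_compact_biprod_cat_scheme \<Rightarrow> 'a \<Rightarrow> 'a \<Rightarrow> 'a \<Rightarrow> 'a \<Rightarrow> 'a"
    ("\<langle>_, _, _, _\<rangle>\<index>") where
  "\<langle>f1, f2, f3, f4\<rangle>\<^bsub>C\<^esub> =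
    (THE h. h \<in> hom C (source C f1) (four\<^bsub>C\<^esub> (target C f1)) \<and>
       four_proj C (target C f1) 1 \<cdot>\<^bsub>C\<^esub> h = f1 \<and>
       four_proj C (target C f1) 2 \<cdot>\<^bsub>C\<^esub> h = f2 \<and>
       four_proj C (target C f1) 3 \<cdot>\<^bsub>C\<^esub> h = f3 \<and>
       four_proj C (target C f1) 4 \<cdot>\<^bsub>C\<^esub> h = f4)"

definition distrib ::
    "('o, 'a, 'm) dagger_compact_biprod_cat_scheme \<Rightarrow> 'o \<Rightarrow> 'a"  ("\<upsilon>\<index>") where
  "\<upsilon>\<^bsub>C\<^esub> Q =
    \<langle>four_proj C \<I>\<^bsub>C\<^esub> 1 \<boxtimes>\<^bsub>C\<^esub> \<one>\<^bsub>C\<^esub> Q,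
     four_proj C \<I>\<^bsub>C\<^esub> 2 \<boxtimes>\<^bsub>C\<^esub> \<one>\<^bsub>C\<^esub> Q,
     four_proj C \<I>\<^bsub>C\<^esub> 3 \<boxtimes>\<^bsub>C\<^esub> \<one>\<^bsub>C\<^esub> Q,
     four_proj C \<I>\<^bsub>C\<^esub> 4 \<boxtimes>\<^bsub>C\<^esub> \<one>\<^bsub>C\<^esub> Q\<rangle>\<^bsub>C\<^esub>"

end

theory Submission
  imports Defs
begin

text \<open>
  An arrow into \<open>4 \<cdot> Q\<close> is determined by its four projections, so it suffices to project the
  protocol to each branch (\<open>four_ext\<close>). Projections commute past every step that acts
  branchwise: past a fourfold biproduct of arrows because this is how it is defined
  (\<open>four_proj_biprod\<close>), and past the distributivity isomorphism and the measurement because these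
  are tuples (\<open>four_proj_tuple\<close>). What remains in branch \<open>i\<close> is \<open>\<beta>\<^sub>i\<^sup>-\<^sup>1\<close> applied to the
  composite that creates an entangled pair and then observes the outcome described by \<open>\<llcorner>\<beta>\<^sub>i\<lrcorner>\<close>.

  That composite is \<open>\<beta>\<^sub>i\<close> itself (\<open>coname_name_yank\<close>):
  naturality slides \<open>\<beta>\<^sub>i\<close> back along its wire to before the creation of the pair, the cup and the
  cap then meet and are straightened by the snake equation, and \<open>\<beta>\<^sub>i\<close> is left between unitors and
  symmetries that cancel. The final correction therefore turns every branch into the identity.
\<close>

section \<open>Composition and inverses\<close>

context category
begin

text \<open>Here and in \<open>assoc3\<close> the typing premises come in the order in which the composite is
  written, so that typings can be combined by reading off the term.\<close>

lemma compose_in_hom: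
  "\<lbrakk>g \<in> hom C b c; f \<in> hom C a b\<rbrakk> \<Longrightarrow> g \<cdot> f \<in> hom C a c"
  by (rule compose_closed)

lemma hom_source: "f \<in> hom C a b \<Longrightarrow> source C f = a"
  and hom_target: "f \<in> hom C a b \<Longrightarrow> target C f = b"
  by (simp_all add: hom_def)

lemma hom_objs: "f \<in> hom C a b \<Longrightarrow> a \<in> Obj C \<and> b \<in> Obj C"
  unfolding hom_def using source_closed target_closed by blast

lemma assoc3:
  "\<lbrakk>h \<in> hom C c d; g \<in> hom C b c; f \<in> hom C a b\<rbrakk> \<Longrightarrow> (h \<cdot> g) \<cdot> f = h \<cdot> g \<cdot> f"
  by (rule compose_assoc)

text \<open>An equation between two-step composites may be applied in front of any further arrow. In
  this form it can rewrite the head of a long right-nested composite.\<close>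

lemma square_precompose:
  assumes "g \<cdot> f = g' \<cdot> f'"
    and "g \<in> hom C b c" "f \<in> hom C a b" "g' \<in> hom C b' c" "f' \<in> hom C a b'" "r \<in> hom C x a"
  shows "g \<cdot> f \<cdot> r = g' \<cdot> f' \<cdot> r"
  using compose_assoc[OF assms(6,3,2)] compose_assoc[OF assms(6,5,4)] assms(1) by simp

lemma inverse_arrows_unique:
  assumes "inverse_arrows C f g" "inverse_arrows C f h"
  shows "g = h"
proof -
  let ?a = "source C f" and ?b = "target C f"
  have f: "f \<in> hom C ?a ?b" and g: "g \<in> hom C ?b ?a" and h: "h \<in> hom C ?b ?a"
    and gf: "g \<cdot> f = \<one> ?a" and fh: "f \<cdot> h = \<one> ?b"
    using assms by (auto simp: inverse_arrows_def hom_def)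
  have "g = g \<cdot> f \<cdot> h" using ident_right[OF g] fh by simp
  also have "\<dots> = h" using compose_assoc[OF h f g] gf ident_left[OF h] by simp
  finally show ?thesis .
qed

lemma inverse_arrow_eq: "inverse_arrows C f g \<Longrightarrow> f\<^sup>-\<^sup>1 = g"
  unfolding inverse_arrow_def by (rule the_equality) (auto intro: inverse_arrows_unique)

lemma inverse_arrow_props:
  assumes "iso_arrow C f" "f \<in> hom C a b"
  shows "f\<^sup>-\<^sup>1 \<in> hom C b a" "f\<^sup>-\<^sup>1 \<cdot> f = \<one> a" "f \<cdot> f\<^sup>-\<^sup>1 = \<one> b"
proof -
  obtain g where g: "inverse_arrows C f g" using assms(1) by (auto simp: iso_arrow_def)
  with inverse_arrow_eq[OF g] assms(2)
  show "f\<^sup>-\<^sup>1 \<in> hom C b a" "f\<^sup>-\<^sup>1 \<cdot> f = \<one> a" "f \<cdot> f\<^sup>-\<^sup>1 = \<one> b"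
    by (auto simp: inverse_arrows_def hom_def)
qed

end

section \<open>Straightening an entangled pair\<close>

context symmetric_monoidal_category
begin

lemma interchange:
  assumes f: "f \<in> hom C a b" and g: "g \<in> hom C c d"
  shows "(f \<boxtimes> \<one> d) \<cdot> (\<one> a \<boxtimes> g) = (\<one> b \<boxtimes> g) \<cdot> (f \<boxtimes> \<one> c)"
proof -
  have objs: "a \<in> Obj C" "b \<in> Obj C" "c \<in> Obj C" "d \<in> Obj C"
    using hom_objs[OF f] hom_objs[OF g] by auto
  note [simp] = ident_left[OF f] ident_right[OF f] ident_left[OF g] ident_right[OF g]
  have "(f \<boxtimes> \<one> d) \<cdot> (\<one> a \<boxtimes> g) = f \<boxtimes> g"
    using tensor_compose[OF ident_closed f g ident_closed] objs by simp
  moreover have "(\<one> b \<boxtimes> g) \<cdot> (f \<boxtimes> \<one> c) = f \<boxtimes> g"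
    using tensor_compose[OF f ident_closed ident_closed g] objs by simp
  ultimately show ?thesis by simp
qed

lemma tensor_compose_ident:
  assumes "f \<in> hom C a b" "g \<in> hom C b c" "x \<in> Obj C"
  shows "(g \<cdot> f) \<boxtimes> \<one> x = (g \<boxtimes> \<one> x) \<cdot> (f \<boxtimes> \<one> x)"
  using tensor_compose[OF assms(1,2) ident_closed ident_closed] assms(3)
    ident_left[OF ident_closed] by simp

text \<open>The two symmetries cancel around an arrow tensored with the unit, and the unitors then carry
  it back to itself.\<close>

lemma unit_conjugate:
  assumes f: "f \<in> hom C a b"
  shows "\<lambda> b \<cdot> \<sigma> b \<I> \<cdot> (f \<boxtimes> \<one> \<I>) \<cdot> \<sigma> \<I> a \<cdot> (\<lambda> a)\<^sup>-\<^sup>1 = f"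
proof -
  have a: "a \<in> Obj C" and b: "b \<in> Obj C" using hom_objs[OF f] by auto
  note I = unit_obj_closed
  have l: "\<lambda> a \<in> hom C (\<I> \<otimes> a) a" and l': "\<lambda> b \<in> hom C (\<I> \<otimes> b) b"
    using lunit_closed a b by auto
  note inv = inverse_arrow_props[OF lunit_iso[OF a] l]
  have fI: "f \<boxtimes> \<one> \<I> \<in> hom C (a \<otimes> \<I>) (b \<otimes> \<I>)" and If: "\<one> \<I> \<boxtimes> f \<in> hom C (\<I> \<otimes> a) (\<I> \<otimes> b)"
    using tensor_arr_closed f ident_closed[OF I] by auto
  have s: "\<sigma> \<I> a \<in> hom C (\<I> \<otimes> a) (a \<otimes> \<I>)" "\<sigma> a \<I> \<in> hom C (a \<otimes> \<I>) (\<I> \<otimes> a)"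
    "\<sigma> b \<I> \<in> hom C (b \<otimes> \<I>) (\<I> \<otimes> b)"
    using sym_closed I a b by auto
  have "\<lambda> b \<cdot> \<sigma> b \<I> \<cdot> (f \<boxtimes> \<one> \<I>) \<cdot> \<sigma> \<I> a \<cdot> (\<lambda> a)\<^sup>-\<^sup>1
      = \<lambda> b \<cdot> (\<one> \<I> \<boxtimes> f) \<cdot> \<sigma> a \<I> \<cdot> \<sigma> \<I> a \<cdot> (\<lambda> a)\<^sup>-\<^sup>1"
    using square_precompose[OF sym_natural[OF f ident_closed[OF I]] s(3) fI If s(2)
        compose_in_hom[OF s(1) inv(1)]] by simp
  also have "\<sigma> a \<I> \<cdot> \<sigma> \<I> a \<cdot> (\<lambda> a)\<^sup>-\<^sup>1 = (\<lambda> a)\<^sup>-\<^sup>1"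
    using assoc3[OF s(2,1) inv(1)] sym_sym[OF I a] ident_left[OF inv(1)] by simp
  also have "\<lambda> b \<cdot> (\<one> \<I> \<boxtimes> f) \<cdot> (\<lambda> a)\<^sup>-\<^sup>1 = f \<cdot> \<lambda> a \<cdot> (\<lambda> a)\<^sup>-\<^sup>1"
    by (rule square_precompose[OF lunit_natural[OF f] l' If f l inv(1)])
  also have "\<dots> = f" using inv(3) ident_right[OF f] by simp
  finally show ?thesis .
qed

end

context compact_closed_category
begin

lemma coname_in_hom:
  assumes f: "f \<in> hom C a b"
  shows "\<llcorner>f\<lrcorner> \<in> hom C (a \<otimes> b\<^sup>\<star>) \<I>"
proof -
  have "b \<in> Obj C" using hom_objs[OF f] by simp
  then show ?thesis
    unfolding coname_def hom_target[OF f]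
    by (intro compose_in_hom[OF dual_counit_closed
          tensor_arr_closed[OF f ident_closed[OF dual_closed]]])
qed

lemma name_ident:
  assumes a: "a \<in> Obj C"
  shows "\<ulcorner>\<one> a\<urcorner> = \<eta> a"
  unfolding name_def hom_source[OF ident_closed[OF a]]
  using tensor_ident[OF dual_closed[OF a] a] ident_left[OF dual_unit_closed[OF a]] by simp

text \<open>The arrow \<open>f\<close> inside the coname acts on a wire that the creation of the pair does not
  touch. Moved in front of that creation, it leaves \<open>\<epsilon>\<close> directly against \<open>\<eta>\<close>, which is the
  left-hand side of the snake equation.\<close>

lemma coname_snake:
  assumes f: "f \<in> hom C a b"
  shows "(\<llcorner>f\<lrcorner> \<boxtimes> \<one> b) \<cdot> \<alpha> a (b\<^sup>\<star>) b \<cdot> (\<one> a \<boxtimes> \<eta> b) = \<sigma> b \<I> \<cdot> (f \<boxtimes> \<one> \<I>)"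
proof -
  have a: "a \<in> Obj C" and b: "b \<in> Obj C" using hom_objs[OF f] by auto
  have d: "b\<^sup>\<star> \<in> Obj C" using dual_closed[OF b] .
  note I = unit_obj_closed and eps = dual_counit_closed[OF b] and eta = dual_unit_closed[OF b]
  note ia = ident_closed[OF a] and ib = ident_closed[OF b] and id = ident_closed[OF d]
    and iI = ident_closed[OF I]
  have fd: "f \<boxtimes> \<one> (b\<^sup>\<star>) \<in> hom C (a \<otimes> b\<^sup>\<star>) (b \<otimes> b\<^sup>\<star>)"
    and fI: "f \<boxtimes> \<one> \<I> \<in> hom C (a \<otimes> \<I>) (b \<otimes> \<I>)"
    using tensor_arr_closed f id iI by auto
  have fdd: "f \<boxtimes> \<one> (b\<^sup>\<star> \<otimes> b) \<in> hom C (a \<otimes> b\<^sup>\<star> \<otimes> b) (b \<otimes> b\<^sup>\<star> \<otimes> b)"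
    using tensor_arr_closed[OF f ident_closed[OF tensor_obj_closed[OF d b]]] .
  note fdb = tensor_arr_closed[OF fd ib] and eb = tensor_arr_closed[OF eps ib]
    and ae = tensor_arr_closed[OF ia eta] and be = tensor_arr_closed[OF ib eta]
  note A = assoc_closed[OF a d b] and B = assoc_closed[OF b d b]
  have "(\<llcorner>f\<lrcorner> \<boxtimes> \<one> b) \<cdot> \<alpha> a (b\<^sup>\<star>) b \<cdot> (\<one> a \<boxtimes> \<eta> b)
      = (\<epsilon> b \<boxtimes> \<one> b) \<cdot> ((f \<boxtimes> \<one> (b\<^sup>\<star>)) \<boxtimes> \<one> b) \<cdot> \<alpha> a (b\<^sup>\<star>) b \<cdot> (\<one> a \<boxtimes> \<eta> b)"
    unfolding coname_def hom_target[OF f]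
    using tensor_compose_ident[OF fd eps b] assoc3[OF eb fdb compose_in_hom[OF A ae]] by simp
  also have "((f \<boxtimes> \<one> (b\<^sup>\<star>)) \<boxtimes> \<one> b) \<cdot> \<alpha> a (b\<^sup>\<star>) b \<cdot> (\<one> a \<boxtimes> \<eta> b)
      = \<alpha> b (b\<^sup>\<star>) b \<cdot> (f \<boxtimes> \<one> (b\<^sup>\<star> \<otimes> b)) \<cdot> (\<one> a \<boxtimes> \<eta> b)"
    using assoc_natural[OF f id ib] tensor_ident[OF d b]
    by (intro square_precompose[OF _ fdb A B fdd ae]) simp
  also have "(f \<boxtimes> \<one> (b\<^sup>\<star> \<otimes> b)) \<cdot> (\<one> a \<boxtimes> \<eta> b) = (\<one> b \<boxtimes> \<eta> b) \<cdot> (f \<boxtimes> \<one> \<I>)"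
    by (rule interchange[OF f eta])
  also have "(\<epsilon> b \<boxtimes> \<one> b) \<cdot> \<alpha> b (b\<^sup>\<star>) b \<cdot> (\<one> b \<boxtimes> \<eta> b) \<cdot> (f \<boxtimes> \<one> \<I>)
      = ((\<epsilon> b \<boxtimes> \<one> b) \<cdot> \<alpha> b (b\<^sup>\<star>) b \<cdot> (\<one> b \<boxtimes> \<eta> b)) \<cdot> (f \<boxtimes> \<one> \<I>)"
    using assoc3[OF B be fI] assoc3[OF eb compose_in_hom[OF B be] fI] by simp
  also have "\<dots> = \<sigma> b \<I> \<cdot> (f \<boxtimes> \<one> \<I>)" using snake[OF b] by simp
  finally show ?thesis .
qed

text \<open>One branch of the protocol before the correction: the state that entered on the first wire
  leaves on the last one, transformed by the arrow whose coname was observed.\<close>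

lemma coname_name_yank:
  assumes f: "f \<in> hom C a b"
  shows "\<lambda> b \<cdot> (\<llcorner>f\<lrcorner> \<boxtimes> \<one> b) \<cdot> \<alpha> a (b\<^sup>\<star>) b \<cdot> (\<one> a \<boxtimes> \<ulcorner>\<one> b\<urcorner>) \<cdot> (\<sigma> \<I> a \<cdot> (\<lambda> a)\<^sup>-\<^sup>1) = f"
proof -
  have a: "a \<in> Obj C" and b: "b \<in> Obj C" using hom_objs[OF f] by auto
  note I = unit_obj_closed and d = dual_closed[OF b]
  note ib = ident_closed[OF b]
  note s = compose_in_hom[OF sym_closed[OF I a]
      inverse_arrow_props(1)[OF lunit_iso[OF a] lunit_closed[OF a]]]
  note cb = tensor_arr_closed[OF coname_in_hom[OF f] ib] and A = assoc_closed[OF a d b]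
    and ae = tensor_arr_closed[OF ident_closed[OF a] dual_unit_closed[OF b]]
    and sb = sym_closed[OF b I] and fI = tensor_arr_closed[OF f ident_closed[OF I]]
  let ?s = "\<sigma> \<I> a \<cdot> (\<lambda> a)\<^sup>-\<^sup>1"
  have "(\<llcorner>f\<lrcorner> \<boxtimes> \<one> b) \<cdot> \<alpha> a (b\<^sup>\<star>) b \<cdot> (\<one> a \<boxtimes> \<eta> b) \<cdot> ?s
      = ((\<llcorner>f\<lrcorner> \<boxtimes> \<one> b) \<cdot> \<alpha> a (b\<^sup>\<star>) b \<cdot> (\<one> a \<boxtimes> \<eta> b)) \<cdot> ?s"
    using assoc3[OF A ae s] assoc3[OF cb compose_in_hom[OF A ae] s] by simp
  also have "\<dots> = \<sigma> b \<I> \<cdot> (f \<boxtimes> \<one> \<I>) \<cdot> ?s"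
    using coname_snake[OF f] assoc3[OF sb fI s] by simp
  finally show ?thesis using name_ident[OF b] unit_conjugate[OF f] by simp
qed

end

section \<open>Fourfold biproducts\<close>

lemma four_cases:
  assumes "i \<in> {1..4::nat}"
  obtains "i = 1" | "i = 2" | "i = 3" | "i = 4"
  using assms by fastforce

lemma ball_four: "(\<forall>i\<in>{1..4::nat}. P i) \<longleftrightarrow> P 1 \<and> P 2 \<and> P 3 \<and> P 4"
proof -
  have "{1..4::nat} = {1, 2, 3, 4}" by auto
  then show ?thesis by simp
qed

context dagger_compact_closed_biproduct_category
begin

lemma biprod_ext:
  assumes "a \<in> Obj C" "b \<in> Obj C" "h \<in> hom C c (a \<oplus> b)" "k \<in> hom C c (a \<oplus> b)"
    and "\<pi>\<^sub>1 a b \<cdot> h = \<pi>\<^sub>1 a b \<cdot> k" "\<pi>\<^sub>2 a b \<cdot> h = \<pi>\<^sub>2 a b \<cdot> k"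
  shows "h = k"
  using product[OF assms(1,2) compose_in_hom[OF proj1_closed[OF assms(1,2)] assms(4)]
      compose_in_hom[OF proj2_closed[OF assms(1,2)] assms(4)]] assms
  by blast

lemma biprod_arr_props:
  assumes f: "f \<in> hom C a a'" and g: "g \<in> hom C b b'"
  shows "f \<boxplus> g \<in> hom C (a \<oplus> b) (a' \<oplus> b')"
    and "\<pi>\<^sub>1 a' b' \<cdot> (f \<boxplus> g) = f \<cdot> \<pi>\<^sub>1 a b"
    and "\<pi>\<^sub>2 a' b' \<cdot> (f \<boxplus> g) = g \<cdot> \<pi>\<^sub>2 a b"
proof -
  have o: "a \<in> Obj C" "a' \<in> Obj C" "b \<in> Obj C" "b' \<in> Obj C"
    using hom_objs[OF f] hom_objs[OF g] by auto
  note ex = product[OF o(2,4) compose_in_hom[OF f proj1_closed[OF o(1,3)]]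
      compose_in_hom[OF g proj2_closed[OF o(1,3)]]]
  show "f \<boxplus> g \<in> hom C (a \<oplus> b) (a' \<oplus> b')"
    and "\<pi>\<^sub>1 a' b' \<cdot> (f \<boxplus> g) = f \<cdot> \<pi>\<^sub>1 a b"
    and "\<pi>\<^sub>2 a' b' \<cdot> (f \<boxplus> g) = g \<cdot> \<pi>\<^sub>2 a b"
    using theI'[OF ex]
    unfolding biprod_arr_def hom_source[OF f] hom_target[OF f] hom_source[OF g] hom_target[OF g]
    by auto
qed

lemma four_proj_closed: "a \<in> Obj C \<Longrightarrow> four_proj C a i \<in> hom C (four a) a"
  unfolding four_proj_def four_obj_def
  by (auto intro!: biprod_obj_closed compose_in_hom[OF proj1_closed]
      compose_in_hom[OF proj2_closed] proj1_closed proj2_closed)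

lemma four_proj_compose:
  assumes a: "a \<in> Obj C" and h: "h \<in> hom C c (four a)"
  shows "four_proj C a 1 \<cdot> h = \<pi>\<^sub>1 a a \<cdot> \<pi>\<^sub>1 (a \<oplus> a) a \<cdot> \<pi>\<^sub>1 (a \<oplus> a \<oplus> a) a \<cdot> h"
    and "four_proj C a 2 \<cdot> h = \<pi>\<^sub>2 a a \<cdot> \<pi>\<^sub>1 (a \<oplus> a) a \<cdot> \<pi>\<^sub>1 (a \<oplus> a \<oplus> a) a \<cdot> h"
    and "four_proj C a 3 \<cdot> h = \<pi>\<^sub>2 (a \<oplus> a) a \<cdot> \<pi>\<^sub>1 (a \<oplus> a \<oplus> a) a \<cdot> h"
    and "four_proj C a 4 \<cdot> h = \<pi>\<^sub>2 (a \<oplus> a \<oplus> a) a \<cdot> h"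
proof -
  have a2: "a \<oplus> a \<in> Obj C" and a3: "a \<oplus> a \<oplus> a \<in> Obj C" using a biprod_obj_closed by auto
  note h = h[unfolded four_obj_def]
  note p = proj1_closed[OF a3 a] and q = proj1_closed[OF a2 a]
  note qp = compose_in_hom[OF q p]
  show "four_proj C a 1 \<cdot> h = \<pi>\<^sub>1 a a \<cdot> \<pi>\<^sub>1 (a \<oplus> a) a \<cdot> \<pi>\<^sub>1 (a \<oplus> a \<oplus> a) a \<cdot> h"
    by (simp add: four_proj_def assoc3[OF proj1_closed[OF a a] qp h] assoc3[OF q p h])
  show "four_proj C a 2 \<cdot> h = \<pi>\<^sub>2 a a \<cdot> \<pi>\<^sub>1 (a \<oplus> a) a \<cdot> \<pi>\<^sub>1 (a \<oplus> a \<oplus> a) a \<cdot> h"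
    by (simp add: four_proj_def assoc3[OF proj2_closed[OF a a] qp h] assoc3[OF q p h])
  show "four_proj C a 3 \<cdot> h = \<pi>\<^sub>2 (a \<oplus> a) a \<cdot> \<pi>\<^sub>1 (a \<oplus> a \<oplus> a) a \<cdot> h"
    by (simp add: four_proj_def assoc3[OF proj2_closed[OF a2 a] p h])
  show "four_proj C a 4 \<cdot> h = \<pi>\<^sub>2 (a \<oplus> a \<oplus> a) a \<cdot> h"
    by (simp add: four_proj_def)
qed

lemma four_ext:
  assumes a: "a \<in> Obj C" and h: "h \<in> hom C c (four a)" and k: "k \<in> hom C c (four a)"
    and eq: "\<And>i. i \<in> {1..4} \<Longrightarrow> four_proj C a i \<cdot> h = four_proj C a i \<cdot> k"
  shows "h = k"
proof -
  have a2: "a \<oplus> a \<in> Obj C" and a3: "a \<oplus> a \<oplus> a \<in> Obj C" using a biprod_obj_closed by auto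
  note hk = h[unfolded four_obj_def] k[unfolded four_obj_def]
  have e: "four_proj C a 1 \<cdot> h = four_proj C a 1 \<cdot> k" "four_proj C a 2 \<cdot> h = four_proj C a 2 \<cdot> k"
    "four_proj C a 3 \<cdot> h = four_proj C a 3 \<cdot> k" "four_proj C a 4 \<cdot> h = four_proj C a 4 \<cdot> k"
    using eq by auto
  note e = e[unfolded four_proj_compose[OF a h] four_proj_compose[OF a k]]
  note ph = compose_in_hom[OF proj1_closed[OF a3 a] hk(1)]
    and pk = compose_in_hom[OF proj1_closed[OF a3 a] hk(2)]
  note qh = compose_in_hom[OF proj1_closed[OF a2 a] ph]
    and qk = compose_in_hom[OF proj1_closed[OF a2 a] pk]
  have "\<pi>\<^sub>1 (a \<oplus> a) a \<cdot> \<pi>\<^sub>1 (a \<oplus> a \<oplus> a) a \<cdot> h = \<pi>\<^sub>1 (a \<oplus> a) a \<cdot> \<pi>\<^sub>1 (a \<oplus> a \<oplus> a) a \<cdot> k"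
    by (rule biprod_ext[OF a a qh qk e(1,2)])
  then have "\<pi>\<^sub>1 (a \<oplus> a \<oplus> a) a \<cdot> h = \<pi>\<^sub>1 (a \<oplus> a \<oplus> a) a \<cdot> k"
    by (rule biprod_ext[OF a2 a ph pk _ e(3)])
  then show ?thesis by (rule biprod_ext[OF a3 a hk _ e(4)])
qed

lemma four_tuple_props:
  assumes a: "a \<in> Obj C" and f: "\<And>i. i \<in> {1..4} \<Longrightarrow> f i \<in> hom C c a"
  shows "\<langle>f 1, f 2, f 3, f 4\<rangle> \<in> hom C c (four a) \<and>
    (\<forall>i\<in>{1..4}. four_proj C a i \<cdot> \<langle>f 1, f 2, f 3, f 4\<rangle> = f i)"
proof -
  have a2: "a \<oplus> a \<in> Obj C" and a3: "a \<oplus> a \<oplus> a \<in> Obj C" using a biprod_obj_closed by auto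
  have f1: "f 1 \<in> hom C c a" and f2: "f 2 \<in> hom C c a" and f3: "f 3 \<in> hom C c a"
    and f4: "f 4 \<in> hom C c a" using f by auto
  obtain h2 where h2: "h2 \<in> hom C c (a \<oplus> a)" "\<pi>\<^sub>1 a a \<cdot> h2 = f 1" "\<pi>\<^sub>2 a a \<cdot> h2 = f 2"
    using product[OF a a f1 f2] by blast
  obtain h3 where h3: "h3 \<in> hom C c (a \<oplus> a \<oplus> a)"
    "\<pi>\<^sub>1 (a \<oplus> a) a \<cdot> h3 = h2" "\<pi>\<^sub>2 (a \<oplus> a) a \<cdot> h3 = f 3"
    using product[OF a2 a h2(1) f3] by blast
  obtain h where h: "h \<in> hom C c (four a)"
    "\<pi>\<^sub>1 (a \<oplus> a \<oplus> a) a \<cdot> h = h3" "\<pi>\<^sub>2 (a \<oplus> a \<oplus> a) a \<cdot> h = f 4"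
    using product[OF a3 a h3(1) f4] unfolding four_obj_def by blast
  let ?P = "%h. h \<in> hom C c (four a) \<and> (\<forall>i\<in>{1..4}. four_proj C a i \<cdot> h = f i)"
  have "?P h" unfolding ball_four four_proj_compose[OF a h(1)] using h h3 h2 by simp
  moreover have "h' = h" if "?P h'" for h'
    using that \<open>?P h\<close> by (auto intro: four_ext[OF a])
  ultimately have "?P (THE h. ?P h)" by (rule theI)
  then show ?thesis
    unfolding four_tuple_def hom_source[OF f1] hom_target[OF f1] ball_four .
qed

lemmas four_tuple_closed = four_tuple_props[THEN conjunct1]
  and four_proj_tuple = four_tuple_props[THEN conjunct2, rule_format]

lemma four_biprod_closed:
  fixes f :: "nat \<Rightarrow> 'a"
  assumes "\<And>i. i \<in> {1..4} \<Longrightarrow> f i \<in> hom C a b"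
  shows "f 1 \<boxplus> f 2 \<boxplus> f 3 \<boxplus> f 4 \<in> hom C (four a) (four b)"
  unfolding four_obj_def using assms by (auto intro!: biprod_arr_props(1))

lemma four_proj_biprod:
  assumes f: "\<And>i. i \<in> {1..4} \<Longrightarrow> f i \<in> hom C a b" and i: "i \<in> {1..4}"
  shows "four_proj C b i \<cdot> (f 1 \<boxplus> f 2 \<boxplus> f 3 \<boxplus> f 4) = f i \<cdot> four_proj C a i"
proof -
  have f1: "f 1 \<in> hom C a b" and f2: "f 2 \<in> hom C a b" and f3: "f 3 \<in> hom C a b"
    and f4: "f 4 \<in> hom C a b" using f by auto
  have a: "a \<in> Obj C" and b: "b \<in> Obj C" using hom_objs[OF f1] by auto
  have a2: "a \<oplus> a \<in> Obj C" and a3: "a \<oplus> a \<oplus> a \<in> Obj C" using a biprod_obj_closed by auto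
  have b2: "b \<oplus> b \<in> Obj C" and b3: "b \<oplus> b \<oplus> b \<in> Obj C" using b biprod_obj_closed by auto
  note g2 = biprod_arr_props[OF f1 f2]
  note g3 = biprod_arr_props[OF g2(1) f3]
  note g4 = biprod_arr_props[OF g3(1) f4]
  note P3 = proj1_closed[OF a3 a] and P2 = proj1_closed[OF a2 a]
  \<comment> \<open>Each nested projection passes one level of the biproduct, leaving the next level inside.\<close>
  note s2 = square_precompose[OF g3(2) proj1_closed[OF b2 b] g3(1) g2(1) P2 P3]
    and s2' = square_precompose[OF g3(3) proj2_closed[OF b2 b] g3(1) f3 proj2_closed[OF a2 a] P3]
    and s1 = square_precompose[OF g2(2) proj1_closed[OF b b] g2(1) f1 proj1_closed[OF a a]
        compose_in_hom[OF P2 P3]]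
    and s1' = square_precompose[OF g2(3) proj2_closed[OF b b] g2(1) f2 proj2_closed[OF a a]
        compose_in_hom[OF P2 P3]]
  note comp = four_proj_compose[OF b four_biprod_closed[of f, OF f]]
  from i show ?thesis
  proof (cases rule: four_cases)
    case 1 then show ?thesis using comp(1) g4(2) s2 s1 by (simp add: four_proj_def)
  next
    case 2 then show ?thesis using comp(2) g4(2) s2 s1' by (simp add: four_proj_def)
  next
    case 3 then show ?thesis using comp(3) g4(2) s2' by (simp add: four_proj_def)
  next
    case 4 then show ?thesis using comp(4) g4(3) by (simp add: four_proj_def)
  qed
qed

lemma distrib_closed:
  assumes "a \<in> Obj C"
  shows "\<upsilon> a \<in> hom C (four \<I> \<otimes> a) (four (\<I> \<otimes> a))"
  unfolding distrib_def
  by (rule four_tuple_closed[of _ "%i. four_proj C \<I> i \<boxtimes> \<one> a"])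
    (intro tensor_obj_closed tensor_arr_closed four_proj_closed ident_closed unit_obj_closed assms)+

lemma four_proj_distrib:
  assumes "a \<in> Obj C" "i \<in> {1..4}"
  shows "four_proj C (\<I> \<otimes> a) i \<cdot> \<upsilon> a = four_proj C \<I> i \<boxtimes> \<one> a"
  unfolding distrib_def
  using four_proj_tuple[of _ "%i. four_proj C \<I> i \<boxtimes> \<one> a",
      OF tensor_obj_closed[OF unit_obj_closed assms(1)]
        tensor_arr_closed[OF four_proj_closed[OF unit_obj_closed] ident_closed[OF assms(1)]] assms(2)] .

section \<open>The teleportation protocol\<close>

text \<open>Projecting the four outcomes after the measurement has been distributed over the second
  system selects a single measurement outcome.\<close>

lemma four_proj_measure:
  assumes a: "a \<in> Obj C" and m: "\<And>i. i \<in> {1..4} \<Longrightarrow> m i \<in> hom C c \<I>" and i: "i \<in> {1..4}"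
  shows "four_proj C a i \<cdot> ((fourarr (\<lambda> a)) \<cdot> \<upsilon> a) \<cdot> (\<langle>m 1, m 2, m 3, m 4\<rangle> \<boxtimes> \<one> a)
    = \<lambda> a \<cdot> (m i \<boxtimes> \<one> a)"
proof -
  note I = unit_obj_closed
  note Ia = tensor_obj_closed[OF I a] and l = lunit_closed[OF a] and ia = ident_closed[OF a]
  have L: "fourarr (\<lambda> a) \<in> hom C (four (\<I> \<otimes> a)) (four a)"
    and pL: "four_proj C a i \<cdot> fourarr (\<lambda> a) = \<lambda> a \<cdot> four_proj C (\<I> \<otimes> a) i"
    unfolding four_arr_def
    using four_biprod_closed[of "%_. \<lambda> a"] four_proj_biprod[of "%_. \<lambda> a"] l i by auto
  have T: "\<langle>m 1, m 2, m 3, m 4\<rangle> \<in> hom C c (four \<I>)" by (rule four_tuple_closed[OF I m])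
  note U = distrib_closed[OF a] and p = four_proj_closed[OF a] and pI = four_proj_closed[OF Ia, of i]
  let ?T = "\<langle>m 1, m 2, m 3, m 4\<rangle> \<boxtimes> \<one> a"
  note T' = tensor_arr_closed[OF T ia]
  have "four_proj C a i \<cdot> ((fourarr (\<lambda> a)) \<cdot> \<upsilon> a) \<cdot> ?T
      = four_proj C a i \<cdot> fourarr (\<lambda> a) \<cdot> \<upsilon> a \<cdot> ?T"
    using assoc3[OF L U T'] by simp
  also have "\<dots> = \<lambda> a \<cdot> four_proj C (\<I> \<otimes> a) i \<cdot> \<upsilon> a \<cdot> ?T"
    by (rule square_precompose[OF pL p L l pI compose_in_hom[OF U T']])
  also have "four_proj C (\<I> \<otimes> a) i \<cdot> \<upsilon> a \<cdot> ?T = (four_proj C \<I> i \<boxtimes> \<one> a) \<cdot> ?T"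
    using assoc3[OF pI U T'] four_proj_distrib[OF a i] by simp
  also have "\<dots> = m i \<boxtimes> \<one> a"
    using tensor_compose_ident[OF T four_proj_closed[OF I] a, of i] four_proj_tuple[of _ m, OF I m i] by simp
  finally show ?thesis .
qed

text \<open>The correction has to undo the arrow left behind in its branch, so \<open>\<gamma> i\<close> is a left inverse
  of \<open>\<beta> i\<close>; a unitary arrow has its categorical inverse as such a correction.\<close>

lemma teleportation:
  fixes \<beta> \<gamma> :: "nat \<Rightarrow> 'a"
  assumes Q: "Q \<in> Obj C"
    and \<beta>: "\<And>i. i \<in> {1..4} \<Longrightarrow> \<beta> i \<in> hom C Q Q"
    and \<gamma>: "\<And>i. i \<in> {1..4} \<Longrightarrow> \<gamma> i \<in> hom C Q Q"
    and inv: "\<And>i. i \<in> {1..4} \<Longrightarrow> \<gamma> i \<cdot> \<beta> i = \<one> Q"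
  shows "(\<gamma> 1 \<boxplus> \<gamma> 2 \<boxplus> \<gamma> 3 \<boxplus> \<gamma> 4)
         \<cdot> ((fourarr (\<lambda> Q)) \<cdot> \<upsilon> Q)
         \<cdot> (\<langle>\<llcorner>\<beta> 1\<lrcorner>, \<llcorner>\<beta> 2\<lrcorner>, \<llcorner>\<beta> 3\<lrcorner>, \<llcorner>\<beta> 4\<lrcorner>\<rangle> \<boxtimes> \<one> Q)
         \<cdot> \<alpha> Q (Q\<^sup>\<star>) Q
         \<cdot> (\<one> Q \<boxtimes> \<ulcorner>\<one> Q\<urcorner>)
         \<cdot> (\<sigma> \<I> Q \<cdot> (\<lambda> Q)\<^sup>-\<^sup>1)
       = \<langle>\<one> Q, \<one> Q, \<one> Q, \<one> Q\<rangle>"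
    (is "?G \<cdot> ?M \<cdot> ?T \<cdot> ?R = _")
proof (rule four_ext[OF Q])
  note I = unit_obj_closed and d = dual_closed[OF Q] and iQ = ident_closed[OF Q]
  note l = lunit_closed[OF Q]
  have m: "\<llcorner>\<beta> i\<lrcorner> \<in> hom C (Q \<otimes> Q\<^sup>\<star>) \<I>" if "i \<in> {1..4}" for i
    using \<beta>[OF that] by (rule coname_in_hom)
  have R: "?R \<in> hom C Q ((Q \<otimes> Q\<^sup>\<star>) \<otimes> Q)"
    unfolding name_ident[OF Q]
    by (intro compose_in_hom[OF assoc_closed[OF Q d Q]]
        compose_in_hom[OF tensor_arr_closed[OF iQ dual_unit_closed[OF Q]]]
        compose_in_hom[OF sym_closed[OF I Q]] inverse_arrow_props(1) lunit_iso[OF Q] l)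
  have G: "?G \<in> hom C (four Q) (four Q)" by (rule four_biprod_closed[OF \<gamma>])
  have L: "fourarr (\<lambda> Q) \<in> hom C (four (\<I> \<otimes> Q)) (four Q)"
    unfolding four_arr_def using four_biprod_closed[of "%_. \<lambda> Q"] l by auto
  note M = compose_in_hom[OF L distrib_closed[OF Q]]
  have "\<langle>\<llcorner>\<beta> 1\<lrcorner>, \<llcorner>\<beta> 2\<lrcorner>, \<llcorner>\<beta> 3\<lrcorner>, \<llcorner>\<beta> 4\<lrcorner>\<rangle> \<in> hom C (Q \<otimes> Q\<^sup>\<star>) (four \<I>)"
    by (rule four_tuple_closed[of _ "%i. \<llcorner>\<beta> i\<lrcorner>", OF I m])
  note T = tensor_arr_closed[OF this iQ]
  note TR = compose_in_hom[OF T R]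
  note MTR = compose_in_hom[OF M TR]
  show "?G \<cdot> ?M \<cdot> ?T \<cdot> ?R \<in> hom C Q (four Q)" by (rule compose_in_hom[OF G MTR])
  show "\<langle>\<one> Q, \<one> Q, \<one> Q, \<one> Q\<rangle> \<in> hom C Q (four Q)"
    by (rule four_tuple_closed[OF Q, of "%_. \<one> Q"]) (rule iQ)
  fix i :: nat assume i: "i \<in> {1..4}"
  note p = four_proj_closed[OF Q, of i]
  have "four_proj C Q i \<cdot> ?G \<cdot> ?M \<cdot> ?T \<cdot> ?R = \<gamma> i \<cdot> four_proj C Q i \<cdot> ?M \<cdot> ?T \<cdot> ?R"
    by (rule square_precompose[OF four_proj_biprod[OF \<gamma> i] p G \<gamma>[OF i] p MTR])
  also have "four_proj C Q i \<cdot> ?M \<cdot> ?T \<cdot> ?R = (four_proj C Q i \<cdot> ?M \<cdot> ?T) \<cdot> ?R"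
    using assoc3[OF M T R] assoc3[OF p compose_in_hom[OF M T] R] by simp
  also have "four_proj C Q i \<cdot> ?M \<cdot> ?T = \<lambda> Q \<cdot> (\<llcorner>\<beta> i\<lrcorner> \<boxtimes> \<one> Q)"
    by (rule four_proj_measure[of _ "%i. \<llcorner>\<beta> i\<lrcorner>", OF Q m i])
  also have "(\<lambda> Q \<cdot> (\<llcorner>\<beta> i\<lrcorner> \<boxtimes> \<one> Q)) \<cdot> ?R = \<lambda> Q \<cdot> (\<llcorner>\<beta> i\<lrcorner> \<boxtimes> \<one> Q) \<cdot> ?R"
    by (rule assoc3[OF l tensor_arr_closed[OF m[OF i] iQ] R])
  also have "\<dots> = \<beta> i" by (rule coname_name_yank[OF \<beta>[OF i]])
  also have "\<gamma> i \<cdot> \<beta> i = \<one> Q" by (rule inv[OF i])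
  also have "\<one> Q = four_proj C Q i \<cdot> \<langle>\<one> Q, \<one> Q, \<one> Q, \<one> Q\<rangle>"
    by (rule four_proj_tuple[OF Q, of "%_. \<one> Q", symmetric]) (rule iQ, rule i)
  finally show "four_proj C Q i \<cdot> ?G \<cdot> ?M \<cdot> ?T \<cdot> ?R
      = four_proj C Q i \<cdot> \<langle>\<one> Q, \<one> Q, \<one> Q, \<one> Q\<rangle>" .
qed

end

theorem mainTheorem3:
  fixes C :: "('o, 'a, 'm) dagger_compact_biprod_cat_scheme" (structure)
    and Q :: 'o and \<beta>1 \<beta>2 \<beta>3 \<beta>4 :: 'a
  assumes "dagger_compact_closed_biproduct_category C"
    and "Q \<in> Obj C"
    and "\<beta>1 \<in> hom C Q Q" and "\<beta>2 \<in> hom C Q Q" and "\<beta>3 \<in> hom C Q Q" and "\<beta>4 \<in> hom C Q Q"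
    and "unitary C \<beta>1" and "unitary C \<beta>2" and "unitary C \<beta>3" and "unitary C \<beta>4"
  shows "(\<beta>1\<^sup>-\<^sup>1 \<boxplus> \<beta>2\<^sup>-\<^sup>1 \<boxplus> \<beta>3\<^sup>-\<^sup>1 \<boxplus> \<beta>4\<^sup>-\<^sup>1)
         \<cdot> ((fourarr (\<lambda> Q)) \<cdot> \<upsilon> Q)
         \<cdot> (\<langle>\<llcorner>\<beta>1\<lrcorner>, \<llcorner>\<beta>2\<lrcorner>, \<llcorner>\<beta>3\<lrcorner>, \<llcorner>\<beta>4\<lrcorner>\<rangle> \<boxtimes> \<one> Q)
         \<cdot> \<alpha> Q (Q\<^sup>\<star>) Q
         \<cdot> (\<one> Q \<boxtimes> \<ulcorner>\<one> Q\<urcorner>)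
         \<cdot> (\<sigma> \<I> Q \<cdot> (\<lambda> Q)\<^sup>-\<^sup>1)
       = \<langle>\<one> Q, \<one> Q, \<one> Q, \<one> Q\<rangle>"
proof -
  interpret dagger_compact_closed_biproduct_category C by fact
  define \<beta> where "\<beta> i = [\<beta>1, \<beta>2, \<beta>3, \<beta>4] ! (i - 1)" for i :: nat
  have \<beta>_simps: "\<beta> 1 = \<beta>1" "\<beta> 2 = \<beta>2" "\<beta> 3 = \<beta>3" "\<beta> 4 = \<beta>4"
    by (simp_all add: \<beta>_def numeral_eq_Suc)
  have \<beta>: "\<beta> i \<in> hom C Q Q" and iso: "iso_arrow C (\<beta> i)" if "i \<in> {1..4}" for i
    using that assms \<beta>_simps unfolding iso_arrow_def unitary_def
    by (cases rule: four_cases; force)+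
  show ?thesis
    using teleportation[OF \<open>Q \<in> Obj C\<close>, of \<beta> "%i. (\<beta> i)\<^sup>-\<^sup>1"] \<beta> inverse_arrow_props[OF iso \<beta>]
    unfolding \<beta>_simps by blast
qed

end
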